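(* The Levi-Civita connection $\nabla^W$ of $(\mathcal{P}_+(G),g_W)$ is given, at $\rho\in\mathcal{P}_+(G)$ and for $\sigma_1,\sigma_2\in T_\rho\mathcal{P}_+(G)$ (regarded as constant vector fields), by $$\nabla^W_{\sigma_1}\sigma_2=-\frac12\big[L(\sigma_1)L(\rho)^\dagger\sigma_2+L(\sigma_2)L(\rho)^\dagger\sigma_1\big]+\frac12L(\rho)\Big(\nabla_GL(\rho)^\dagger\sigma_1\circ\nabla_GL(\rho)^\dagger\sigma_2\Big),$$ where $$\nabla_GL(\rho)^\dagger\sigma_1\circ\nabla_GL(\rho)^\dagger\sigma_2=\frac12\Big(\sum_{j\in N(i)}(\nabla_{ij}L(\rho)^\dagger\sigma_1)(\nabla_{ij}L(\rho)^\dagger\sigma_2)\Big)_{i=1}^n\in\mathbb{R}^n.$$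
   Context: $G=(V,E,\omega)$ is a connected, weighted, undirected finite graph with vertex set $V=\{1,\dots,n\}$, edge set $E$ and weights $\omega_{ij}=\omega_{ji}>0$ if $(i,j)\in E$, $\omega_{ij}=0$ otherwise; $N(i)=\{j:(i,j)\in E\}$. For $\Phi\in\mathbb{R}^n$, $\nabla_G\Phi=(\nabla_{ij}\Phi)$ with $\nabla_{ij}\Phi=\sqrt{\omega_{ij}}(\Phi(i)-\Phi(j))$. For $a\in\mathbb{R}^n$ put $\theta_{ij}(a)=\frac{a_i+a_j}{2}$; the linear weighted Laplacian matrix $L(a)\in\mathbb{R}^{n\times n}$ (linear in $a$) is given by $(L(a)\Phi)(i)=\sum_{j\in N(i)}\omega_{ij}\theta_{ij}(a)(\Phi(i)-\Phi(j))$. $A^\dagger$ is the Moore-Penrose pseudo-inverse. $\mathcal{P}_+(G)=\{\rho\in\mathbb{R}^n:\sum_i\rho_i=1,\ \rho_i>0\}$, with tangent space $T_\rho\mathcal{P}_+(G)=\{\sigma\in\mathbb{R}^n:\sum_i\sigma_i=0\}$, carries the Riemannian metric $g_W(\sigma_1,\sigma_2)=\sigma_1^{\mathsf T}L(\rho)^\dagger\sigma_2$. All tangent spaces are the same linear space, so a vector $\sigma$ in it defines a constant vector field on $\mathcal{P}_+(G)$. *)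

theory Defs
  imports "HOL-Analysis.Analysis"
begin

section \<open>Weighted graphs and the weighted Laplacian\<close>

text \<open>The vertex set is the whole of the finite type \<open>'n\<close>. The edge set is a symmetric
  relation.\<close>

definition connected_weighted_graph :: "('n::finite \<times> 'n) set \<Rightarrow> ('n \<Rightarrow> 'n \<Rightarrow> real) \<Rightarrow> bool" where
  "connected_weighted_graph E \<omega> \<longleftrightarrow>
     sym E \<and> (\<forall>i j. (i, j) \<in> E\<^sup>*) \<and>
     (\<forall>i j. \<omega> i j = \<omega> j i) \<and>
     (\<forall>i j. (i, j) \<in> E \<longrightarrow> \<omega> i j > 0) \<and>
     (\<forall>i j. (i, j) \<notin> E \<longrightarrow> \<omega> i j = 0)"

definition nbrs :: "('n \<times> 'n) set \<Rightarrow> 'n \<Rightarrow> 'n set" where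
  "nbrs E i = {j. (i, j) \<in> E}"

definition graph_gradient :: "('n \<Rightarrow> 'n \<Rightarrow> real) \<Rightarrow> real ^ 'n \<Rightarrow> 'n \<Rightarrow> 'n \<Rightarrow> real" where
  "graph_gradient \<omega> \<Phi> i j = sqrt (\<omega> i j) * (\<Phi> $ i - \<Phi> $ j)"

definition edge_product ::
  "('n::finite \<times> 'n) set \<Rightarrow> ('n \<Rightarrow> 'n \<Rightarrow> real) \<Rightarrow> ('n \<Rightarrow> 'n \<Rightarrow> real) \<Rightarrow> real ^ 'n" where
  "edge_product E u v = (\<chi> i. (1/2) * (\<Sum>j\<in>nbrs E i. u i j * v i j))"

definition edge_mean :: "real ^ 'n \<Rightarrow> 'n \<Rightarrow> 'n \<Rightarrow> real" where
  "edge_mean a i j = (a $ i + a $ j) / 2"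

definition laplacian :: "('n::finite \<times> 'n) set \<Rightarrow> ('n \<Rightarrow> 'n \<Rightarrow> real) \<Rightarrow> real ^ 'n \<Rightarrow> real ^ 'n ^ 'n" where
  "laplacian E \<omega> a =
     matrix (\<lambda>\<Phi>. \<chi> i. \<Sum>j\<in>nbrs E i. \<omega> i j * edge_mean a i j * (\<Phi> $ i - \<Phi> $ j))"

lemma laplacian_mult_vec:
  "(laplacian E \<omega> a *v \<Phi>) $ i = (\<Sum>j\<in>nbrs E i. \<omega> i j * edge_mean a i j * (\<Phi> $ i - \<Phi> $ j))"
proof -
  have "linear (\<lambda>\<Phi>. \<chi> i. \<Sum>j\<in>nbrs E i. \<omega> i j * edge_mean a i j * (\<Phi> $ i - \<Phi> $ j))"
    by (rule linearI)
      (simp_all add: vec_eq_iff sum.distrib [symmetric] sum_distrib_left algebra_simps)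
  then show ?thesis
    unfolding laplacian_def by (subst matrix_works) (simp_all add: linear_matrix_vector_mul_eq)
qed

section \<open>Moore-Penrose pseudo-inverse\<close>

definition is_pseudo_inverse :: "real ^ 'n ^ 'm \<Rightarrow> real ^ 'm ^ 'n \<Rightarrow> bool" where
  "is_pseudo_inverse A X \<longleftrightarrow>
     A ** X ** A = A \<and> X ** A ** X = X \<and>
     transpose (A ** X) = A ** X \<and> transpose (X ** A) = X ** A"

definition pseudo_inverse :: "real ^ 'n ^ 'm \<Rightarrow> real ^ 'm ^ 'n" where
  "pseudo_inverse A = (THE X. is_pseudo_inverse A X)"

section \<open>Connections on open subsets of affine subspaces\<close>

text \<open>Below, \<open>M\<close> is a relatively open subset of a translate of the linear subspace \<open>T\<close>. It is a
  manifold with a single affine chart, and every tangent space is \<open>T\<close>. Functions and vector fields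
  on \<open>M\<close> are represented by total functions of which only the values on \<open>M\<close> matter; for \<open>x \<in> M\<close> and
  \<open>v \<in> T\<close> the derivative \<open>dir_deriv f x v\<close> depends on these values only.\<close>

definition dir_deriv ::
  "('a::real_normed_vector \<Rightarrow> 'b::real_normed_vector) \<Rightarrow> 'a \<Rightarrow> 'a \<Rightarrow> 'b" where
  "dir_deriv f x v = vector_derivative (\<lambda>t. f (x + t *\<^sub>R v)) (at 0)"

primrec Ck_on ::
  "'a::real_normed_vector set \<Rightarrow> 'a set \<Rightarrow> nat \<Rightarrow> ('a \<Rightarrow> 'b::real_normed_vector) \<Rightarrow> bool" where
  "Ck_on M T 0 f \<longleftrightarrow> continuous_on M f"
| "Ck_on M T (Suc k) f \<longleftrightarrow>
     f differentiable_on M \<and> (\<forall>v\<in>T. Ck_on M T k (\<lambda>x. dir_deriv f x v))"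

definition smooth_on ::
  "'a::real_normed_vector set \<Rightarrow> 'a set \<Rightarrow> ('a \<Rightarrow> 'b::real_normed_vector) \<Rightarrow> bool" where
  "smooth_on M T f \<longleftrightarrow> (\<forall>k. Ck_on M T k f)"

definition vector_fields :: "'a::real_normed_vector set \<Rightarrow> 'a set \<Rightarrow> ('a \<Rightarrow> 'a) set" where
  "vector_fields M T = {X. smooth_on M T X \<and> (\<forall>x\<in>M. X x \<in> T)}"

definition affine_connection ::
  "'a::real_normed_vector set \<Rightarrow> 'a set \<Rightarrow> (('a \<Rightarrow> 'a) \<Rightarrow> ('a \<Rightarrow> 'a) \<Rightarrow> 'a \<Rightarrow> 'a) \<Rightarrow> bool" where
  "affine_connection M T D \<longleftrightarrow>
     (\<forall>X\<in>vector_fields M T. \<forall>Y\<in>vector_fields M T. D X Y \<in> vector_fields M T) \<and>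
     (\<forall>X\<in>vector_fields M T. \<forall>X'\<in>vector_fields M T. \<forall>Y\<in>vector_fields M T. \<forall>x\<in>M.
        D (\<lambda>y. X y + X' y) Y x = D X Y x + D X' Y x) \<and>
     (\<forall>X\<in>vector_fields M T. \<forall>Y\<in>vector_fields M T. \<forall>f::'a \<Rightarrow> real. smooth_on M T f \<longrightarrow>
        (\<forall>x\<in>M. D (\<lambda>y. f y *\<^sub>R X y) Y x = f x *\<^sub>R D X Y x)) \<and>
     (\<forall>X\<in>vector_fields M T. \<forall>Y\<in>vector_fields M T. \<forall>Y'\<in>vector_fields M T. \<forall>x\<in>M.
        D X (\<lambda>y. Y y + Y' y) x = D X Y x + D X Y' x) \<and>
     (\<forall>X\<in>vector_fields M T. \<forall>Y\<in>vector_fields M T. \<forall>f::'a \<Rightarrow> real. smooth_on M T f \<longrightarrow>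
        (\<forall>x\<in>M. D X (\<lambda>y. f y *\<^sub>R Y y) x = dir_deriv f x (X x) *\<^sub>R Y x + f x *\<^sub>R D X Y x))"

text \<open>The Lie bracket in the global affine chart.\<close>

definition lie_bracket ::
  "('a::real_normed_vector \<Rightarrow> 'a) \<Rightarrow> ('a \<Rightarrow> 'a) \<Rightarrow> 'a \<Rightarrow> 'a" where
  "lie_bracket X Y x = dir_deriv Y x (X x) - dir_deriv X x (Y x)"

definition torsion_free ::
  "'a::real_normed_vector set \<Rightarrow> 'a set \<Rightarrow> (('a \<Rightarrow> 'a) \<Rightarrow> ('a \<Rightarrow> 'a) \<Rightarrow> 'a \<Rightarrow> 'a) \<Rightarrow> bool" where
  "torsion_free M T D \<longleftrightarrow>
     (\<forall>X\<in>vector_fields M T. \<forall>Y\<in>vector_fields M T. \<forall>x\<in>M.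
        D X Y x - D Y X x = lie_bracket X Y x)"

definition metric_compatible ::
  "'a::real_normed_vector set \<Rightarrow> 'a set \<Rightarrow> ('a \<Rightarrow> 'a \<Rightarrow> 'a \<Rightarrow> real) \<Rightarrow>
     (('a \<Rightarrow> 'a) \<Rightarrow> ('a \<Rightarrow> 'a) \<Rightarrow> 'a \<Rightarrow> 'a) \<Rightarrow> bool" where
  "metric_compatible M T g D \<longleftrightarrow>
     (\<forall>X\<in>vector_fields M T. \<forall>Y\<in>vector_fields M T. \<forall>Z\<in>vector_fields M T. \<forall>x\<in>M.
        dir_deriv (\<lambda>y. g y (Y y) (Z y)) x (X x) = g x (D X Y x) (Z x) + g x (Y x) (D X Z x))"

definition levi_civita_connection ::
  "'a::real_normed_vector set \<Rightarrow> 'a set \<Rightarrow> ('a \<Rightarrow> 'a \<Rightarrow> 'a \<Rightarrow> real) \<Rightarrow>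
     (('a \<Rightarrow> 'a) \<Rightarrow> ('a \<Rightarrow> 'a) \<Rightarrow> 'a \<Rightarrow> 'a) \<Rightarrow> bool" where
  "levi_civita_connection M T g D \<longleftrightarrow>
     affine_connection M T D \<and> torsion_free M T D \<and> metric_compatible M T g D"

section \<open>The probability simplex and its Wasserstein metric\<close>

definition prob_simplex :: "(real ^ 'n) set" where
  "prob_simplex = {\<rho>. (\<Sum>i\<in>UNIV. \<rho> $ i) = 1 \<and> (\<forall>i. \<rho> $ i > 0)}"

definition simplex_tangent :: "(real ^ 'n) set" where
  "simplex_tangent = {\<sigma>. (\<Sum>i\<in>UNIV. \<sigma> $ i) = 0}"

definition wasserstein_metric ::
  "('n::finite \<times> 'n) set \<Rightarrow> ('n \<Rightarrow> 'n \<Rightarrow> real) \<Rightarrow> real ^ 'n \<Rightarrow> real ^ 'n \<Rightarrow> real ^ 'n \<Rightarrow> real" where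
  "wasserstein_metric E \<omega> \<rho> \<sigma>\<^sub>1 \<sigma>\<^sub>2 = \<sigma>\<^sub>1 \<bullet> (pseudo_inverse (laplacian E \<omega> \<rho>) *v \<sigma>\<^sub>2)"

end

theory Submission
  imports Defs
begin

text \<open>
  Write \<open>P \<rho>\<close> for the pseudo-inverse of \<open>L \<rho>\<close> and \<open>J\<close> (\<open>mean_matrix\<close>) for the orthogonal projection
  onto the constant vectors. Connectedness makes the constants the kernel of \<open>L \<rho>\<close> for positive \<open>\<rho>\<close>,
  so \<open>L \<rho> P \<rho> = P \<rho> L \<rho> = 1 - J\<close> does not depend on \<open>\<rho>\<close>, and it is the identity on the tangent space.
  Hence \<open>P \<tau> - P \<rho> = - P \<tau> L(\<tau> - \<rho>) P \<rho>\<close>, and \<open>P\<close> is smooth with derivative \<open>- P \<rho> L(v) P \<rho>\<close> in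
  direction \<open>v\<close>: it is differentiated as if it were an honest matrix inverse.

  For constant fields \<open>a\<close>, \<open>b\<close>, \<open>c\<close> all Lie brackets vanish, and the Koszul formula
  \<open>2 g(D\<^sub>a b, c) = a g(b, c) + b g(a, c) - c g(a, b)\<close> reads
  \<open>- P b \<bullet> L(a) P c - P a \<bullet> L(b) P c + P a \<bullet> L(c) P b\<close>. In the first two terms \<open>P c\<close> can be isolated
  because \<open>L(a)\<close> is symmetric. In the third \<open>c\<close> sits inside the weights; summing by parts over the
  edges turns it into \<open>c \<bullet> (\<nabla>P a \<circ> \<nabla>P b) = P c \<bullet> L \<rho> (\<nabla>P a \<circ> \<nabla>P b)\<close> (lemma
  \<open>edge_product_dual\<close>). So the expression in the theorem, called \<open>wasserstein_christoffel\<close>, satisfies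
  the Koszul formula (\<open>christoffel_first_kind\<close>), and nondegeneracy of the metric on tangent vectors
  forces every Levi-Civita connection to agree with it.

  Existence: in the global affine chart, \<open>D\<^sub>X Y = dY(X) + \<Gamma>(X, Y)\<close> is a connection for every smooth
  field \<open>\<Gamma>\<close> of bilinear maps with tangential values; it is torsion-free if \<open>\<Gamma>\<close> is symmetric, and for
  the above \<open>\<Gamma>\<close> it is compatible with the metric, again by the Koszul formula. That \<open>\<Gamma>\<close> is smooth
  needs a product rule and the smoothness of \<open>P\<close>, where \<open>dP = - P L P\<close> raises the order of
  differentiability by induction.
\<close>

section \<open>Smooth maps on a relatively open subset of an affine subspace\<close>

text \<open>
  Relative openness, stated line by line: the admissible \<open>t\<close> may depend on \<open>v\<close>, since tangential
  derivatives are read off along one line at a time.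
\<close>

locale affine_chart =
  fixes M T :: "'a::euclidean_space set"
  assumes subspace_T: "subspace T"
    and line_in_chart: "x \<in> M \<Longrightarrow> v \<in> T \<Longrightarrow> \<forall>\<^sub>F t in nhds 0. x + t *\<^sub>R v \<in> M"
begin

text \<open>
  Derivatives within \<open>M\<close> are not unique as linear maps on the whole space, because \<open>M\<close> has empty
  interior in general. Along \<open>T\<close> they are, since lines in these directions stay in \<open>M\<close> for a while.
\<close>

lemma has_vector_derivative_along_line:
  assumes F: "(f has_derivative F) (at x within M)" and x: "x \<in> M" and v: "v \<in> T"
  shows "((\<lambda>t. f (x + t *\<^sub>R v)) has_vector_derivative F v) (at 0)"
proof -
  obtain U where U: "open U" "0 \<in> U" "\<And>t. t \<in> U \<Longrightarrow> x + t *\<^sub>R v \<in> M"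
    using line_in_chart[OF x v] unfolding eventually_nhds by blast
  have line: "((\<lambda>t. x + t *\<^sub>R v) has_derivative (\<lambda>t. t *\<^sub>R v)) (at 0 within U)"
    by (rule derivative_eq_intros | simp)+
  have "(f has_derivative F) (at (x + 0 *\<^sub>R v) within (\<lambda>t. x + t *\<^sub>R v) ` U)"
    using F U(3) has_derivative_subset[of f F x M "(\<lambda>t. x + t *\<^sub>R v) ` U"] by auto
  from has_derivative_in_compose[where f = "\<lambda>t. x + t *\<^sub>R v" and g = f and g' = F, OF line this]
  have "((\<lambda>t. f (x + t *\<^sub>R v)) has_derivative (\<lambda>t. F (t *\<^sub>R v))) (at 0)"
    by (simp add: at_within_open[OF U(2,1)])
  moreover have "F (t *\<^sub>R v) = t *\<^sub>R F v" for t
    using has_derivative_linear[OF F] by (rule linear_cmul)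
  ultimately show ?thesis
    by (simp add: has_vector_derivative_def)
qed

lemma dir_deriv_eq:
  assumes "(f has_derivative F) (at x within M)" "x \<in> M" "v \<in> T"
  shows "dir_deriv f x v = F v"
  unfolding dir_deriv_def
  by (rule vector_derivative_at) (rule has_vector_derivative_along_line[OF assms])

lemma dir_deriv_cong:
  assumes "\<And>y. y \<in> M \<Longrightarrow> f y = g y" and x: "x \<in> M" and v: "v \<in> T"
  shows "dir_deriv f x v = dir_deriv g x v"
proof -
  have "\<forall>\<^sub>F t in nhds 0. t \<in> UNIV \<longrightarrow> f (x + t *\<^sub>R v) = g (x + t *\<^sub>R v)"
    using line_in_chart[OF x v] by (rule eventually_mono) (simp add: assms(1))
  then show ?thesis
    unfolding dir_deriv_def by (rule vector_derivative_cong_eq) auto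
qed

lemma Ck_on_cong:
  assumes "\<And>x. x \<in> M \<Longrightarrow> f x = g x"
  shows "Ck_on M T k f \<longleftrightarrow> Ck_on M T k g"
  using assms
proof (induction k arbitrary: f g)
  case 0
  then show ?case by (simp cong: continuous_on_cong)
next
  case (Suc k)
  have "f differentiable_on M \<longleftrightarrow> g differentiable_on M"
  proof -
    have "(f has_derivative D) (at x within M) \<longleftrightarrow> (g has_derivative D) (at x within M)"
      if "x \<in> M" for x D
      using Suc.prems that has_derivative_transform[of x M f g D] has_derivative_transform[of x M g f D]
      by auto
    then show ?thesis
      by (simp add: differentiable_on_def differentiable_def)
  qed
  moreover have "Ck_on M T k (\<lambda>x. dir_deriv f x v) \<longleftrightarrow> Ck_on M T k (\<lambda>x. dir_deriv g x v)"
    if "v \<in> T" for v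
    using Suc.prems that by (intro Suc.IH dir_deriv_cong)
  ultimately show ?case by auto
qed

text \<open>
  Recursion through an arbitrary choice of within-derivatives \<open>F\<close> lets the usual derivative rules be
  applied instead of computations with directional derivatives.
\<close>

lemma Ck_on_SucI:
  assumes "\<And>x. x \<in> M \<Longrightarrow> (f has_derivative F x) (at x within M)"
    and "\<And>v. v \<in> T \<Longrightarrow> Ck_on M T k (\<lambda>x. F x v)"
  shows "Ck_on M T (Suc k) f"
proof -
  have "f differentiable_on M"
    using assms(1) unfolding differentiable_on_def differentiable_def by blast
  moreover have "Ck_on M T k (\<lambda>x. dir_deriv f x v)" if "v \<in> T" for v
  proof -
    have "dir_deriv f x v = F x v" if "x \<in> M" for x
      using assms(1)[OF that] that \<open>v \<in> T\<close> by (rule dir_deriv_eq)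
    then show ?thesis
      using assms(2)[OF that] Ck_on_cong[of "\<lambda>x. dir_deriv f x v" "\<lambda>x. F x v" k] by blast
  qed
  ultimately show ?thesis by simp
qed

lemma Ck_on_Suc_deriv:
  assumes "Ck_on M T (Suc k) f"
  obtains F where "\<And>x. x \<in> M \<Longrightarrow> (f has_derivative F x) (at x within M)"
    and "\<And>v. v \<in> T \<Longrightarrow> Ck_on M T k (\<lambda>x. F x v)"
proof -
  obtain F where F: "\<And>x. x \<in> M \<Longrightarrow> (f has_derivative F x) (at x within M)"
    using assms unfolding Ck_on.simps differentiable_on_def differentiable_def by metis
  have "Ck_on M T k (\<lambda>x. F x v)" if "v \<in> T" for v
  proof -
    have "Ck_on M T k (\<lambda>x. dir_deriv f x v)"
      using assms that by simp
    moreover have "dir_deriv f x v = F x v" if "x \<in> M" for x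
      using F[OF that] that \<open>v \<in> T\<close> by (rule dir_deriv_eq)
    ultimately show ?thesis
      using Ck_on_cong[of "\<lambda>x. dir_deriv f x v" "\<lambda>x. F x v" k] by blast
  qed
  with F show ?thesis by (rule that)
qed

lemma Ck_on_lower: "Ck_on M T (Suc k) f \<Longrightarrow> Ck_on M T k f"
proof (induction k arbitrary: f)
  case 0
  then show ?case by (simp add: differentiable_imp_continuous_on)
qed auto

lemma Ck_on_const: "Ck_on M T k (\<lambda>_. c)"
proof (induction k arbitrary: c)
  case 0
  then show ?case by simp
next
  case (Suc k)
  show ?case
    by (rule Ck_on_SucI[where F = "\<lambda>_ _. 0"]) (auto intro: Suc.IH)
qed

lemma Ck_on_add: "Ck_on M T k f \<Longrightarrow> Ck_on M T k g \<Longrightarrow> Ck_on M T k (\<lambda>x. f x + g x)"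
proof (induction k arbitrary: f g)
  case 0
  then show ?case by (simp add: continuous_on_add)
next
  case (Suc k)
  obtain F where F: "\<And>x. x \<in> M \<Longrightarrow> (f has_derivative F x) (at x within M)"
    "\<And>v. v \<in> T \<Longrightarrow> Ck_on M T k (\<lambda>x. F x v)"
    using Ck_on_Suc_deriv[OF Suc.prems(1)] by metis
  obtain G where G: "\<And>x. x \<in> M \<Longrightarrow> (g has_derivative G x) (at x within M)"
    "\<And>v. v \<in> T \<Longrightarrow> Ck_on M T k (\<lambda>x. G x v)"
    using Ck_on_Suc_deriv[OF Suc.prems(2)] by metis
  show ?case
    by (rule Ck_on_SucI[where F = "\<lambda>x v. F x v + G x v"])
      (auto intro!: has_derivative_add F G Suc.IH)
qed

lemma Ck_on_bounded_linear:
  assumes "bounded_linear h"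
  shows "Ck_on M T k f \<Longrightarrow> Ck_on M T k (\<lambda>x. h (f x))"
proof (induction k arbitrary: f)
  case 0
  then show ?case by (simp add: bounded_linear.continuous_on[OF assms])
next
  case (Suc k)
  obtain F where F: "\<And>x. x \<in> M \<Longrightarrow> (f has_derivative F x) (at x within M)"
    "\<And>v. v \<in> T \<Longrightarrow> Ck_on M T k (\<lambda>x. F x v)"
    using Ck_on_Suc_deriv[OF Suc.prems] by metis
  show ?case
    by (rule Ck_on_SucI[where F = "\<lambda>x v. h (F x v)"])
      (auto intro!: bounded_linear.has_derivative[OF assms] F Suc.IH)
qed

text \<open>
  Leibniz' rule expresses the derivative by products of the same kind with one factor differentiated,
  so induction on the order works for all pairs of factors at once.
\<close>

lemma Ck_on_bilinear:
  assumes "bounded_bilinear p"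
  shows "Ck_on M T k f \<Longrightarrow> Ck_on M T k g \<Longrightarrow> Ck_on M T k (\<lambda>x. p (f x) (g x))"
proof (induction k arbitrary: f g)
  case 0
  then show ?case by (simp add: bounded_bilinear.continuous_on[OF assms])
next
  case (Suc k)
  obtain F where F: "\<And>x. x \<in> M \<Longrightarrow> (f has_derivative F x) (at x within M)"
    "\<And>v. v \<in> T \<Longrightarrow> Ck_on M T k (\<lambda>x. F x v)"
    using Ck_on_Suc_deriv[OF Suc.prems(1)] by metis
  obtain G where G: "\<And>x. x \<in> M \<Longrightarrow> (g has_derivative G x) (at x within M)"
    "\<And>v. v \<in> T \<Longrightarrow> Ck_on M T k (\<lambda>x. G x v)"
    using Ck_on_Suc_deriv[OF Suc.prems(2)] by metis
  have lower: "Ck_on M T k f" "Ck_on M T k g"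
    using Suc.prems by (auto dest: Ck_on_lower simp del: Ck_on.simps(2))
  show ?case
    by (rule Ck_on_SucI[where F = "\<lambda>x v. p (f x) (G x v) + p (F x v) (g x)"])
      (auto intro!: bounded_bilinear.FDERIV[OF assms] Ck_on_add F G Suc.IH lower)
qed

lemma Ck_on_sum:
  assumes "\<And>i. i \<in> I \<Longrightarrow> Ck_on M T k (f i)"
  shows "Ck_on M T k (\<lambda>x. \<Sum>i\<in>I. f i x)"
  using assms by (induction I rule: infinite_finite_induct) (auto intro: Ck_on_const Ck_on_add)

lemma Ck_on_ident: "Ck_on M T k (\<lambda>x. x)"
proof (cases k)
  case 0
  then show ?thesis by simp
next
  case (Suc j)
  then show ?thesis
    using Ck_on_SucI[of "\<lambda>x. x" "\<lambda>_ v. v" j] by (auto intro: Ck_on_const)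
qed

lemma smooth_on_const: "smooth_on M T (\<lambda>_. c)"
  by (simp add: smooth_on_def Ck_on_const)

lemma smooth_on_add: "smooth_on M T f \<Longrightarrow> smooth_on M T g \<Longrightarrow> smooth_on M T (\<lambda>x. f x + g x)"
  by (simp add: smooth_on_def Ck_on_add)

lemma smooth_on_has_derivative:
  assumes "smooth_on M T f" "x \<in> M"
  shows "(f has_derivative frechet_derivative f (at x within M)) (at x within M)"
proof -
  have "Ck_on M T (Suc 0) f"
    using assms(1) unfolding smooth_on_def by blast
  with assms(2) show ?thesis
    by (simp add: differentiable_on_def frechet_derivative_works)
qed

lemma dir_deriv_frechet:
  assumes "smooth_on M T f" "x \<in> M" "v \<in> T"
  shows "dir_deriv f x v = frechet_derivative f (at x within M) v"
  using assms by (intro dir_deriv_eq smooth_on_has_derivative)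

text \<open>
  Difference quotients of a \<open>T\<close>-valued map lie in \<open>T\<close>, which is closed.
\<close>

lemma has_derivative_in_T:
  assumes F: "(f has_derivative F) (at x within M)" and x: "x \<in> M" and v: "v \<in> T"
    and f: "\<And>y. y \<in> M \<Longrightarrow> f y \<in> T"
  shows "F v \<in> T"
proof -
  have "((\<lambda>t. (1 / t) *\<^sub>R (f (x + t *\<^sub>R v) - f x)) \<longlongrightarrow> F v) (at 0)"
  proof -
    have "((\<lambda>t. norm (f (x + t *\<^sub>R v) - f x - t *\<^sub>R F v) / norm t) \<longlongrightarrow> 0) (at 0)"
      using has_vector_derivative_along_line[OF F x v]
      by (simp add: has_vector_derivative_def has_derivative_at)
    moreover have "norm (f (x + t *\<^sub>R v) - f x - t *\<^sub>R F v) / norm t =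
        norm ((1 / t) *\<^sub>R (f (x + t *\<^sub>R v) - f x) - F v)" if "t \<noteq> 0" for t
    proof -
      have "f (x + t *\<^sub>R v) - f x - t *\<^sub>R F v = t *\<^sub>R ((1 / t) *\<^sub>R (f (x + t *\<^sub>R v) - f x) - F v)"
        using that by (simp add: scaleR_diff_right)
      then show ?thesis
        using that by simp
    qed
    ultimately have "((\<lambda>t. norm ((1 / t) *\<^sub>R (f (x + t *\<^sub>R v) - f x) - F v)) \<longlongrightarrow> 0) (at 0)"
      by (simp cong: tendsto_cong LIM_cong)
    then show ?thesis
      using LIM_zero_iff tendsto_norm_zero_iff by blast
  qed
  moreover have "\<forall>\<^sub>F t in at 0. (1 / t) *\<^sub>R (f (x + t *\<^sub>R v) - f x) \<in> T"
    using filter_leD[OF at_within_le_nhds line_in_chart[OF x v]]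
    by (rule eventually_mono) (intro subspace_scale subspace_diff subspace_T f x)
  ultimately show ?thesis
    using Lim_in_closed_set[OF closed_subspace[OF subspace_T]] by force
qed

lemma dir_deriv_in_T:
  assumes "Y \<in> vector_fields M T" "x \<in> M" "v \<in> T"
  shows "dir_deriv Y x v \<in> T"
  using assms has_derivative_in_T[OF smooth_on_has_derivative]
  by (simp add: vector_fields_def dir_deriv_frechet)

text \<open>
  Smoothness as defined allows only constant directions of differentiation. Expanding the field in an
  orthonormal basis of \<open>T\<close> reduces variable directions to these.
\<close>

lemma smooth_on_dir_deriv_field:
  assumes Y: "smooth_on M T Y" and X: "X \<in> vector_fields M T"
  shows "smooth_on M T (\<lambda>x. dir_deriv Y x (X x))"
proof -
  obtain B where B: "B \<subseteq> T" "pairwise orthogonal B" "\<And>b. b \<in> B \<Longrightarrow> norm b = 1"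
    "independent B" "span B = T"
    using orthonormal_basis_subspace[OF subspace_T] by metis
  have "finite B"
    using B(4) by (rule independent_imp_finite)
  have expand: "X x = (\<Sum>b\<in>B. (X x \<bullet> b) *\<^sub>R b)" if "x \<in> M" for x
    using orthonormal_basis_expand[OF B(2) B(3), of "X x"] \<open>finite B\<close> B(5) X that
    by (simp add: vector_fields_def)
  have eq: "(\<Sum>b\<in>B. (X x \<bullet> b) *\<^sub>R dir_deriv Y x b) = dir_deriv Y x (X x)" if x: "x \<in> M" for x
  proof -
    let ?F = "frechet_derivative Y (at x within M)"
    have F: "linear ?F"
      using smooth_on_has_derivative[OF Y x] by (rule has_derivative_linear)
    have "dir_deriv Y x (X x) = ?F (\<Sum>b\<in>B. (X x \<bullet> b) *\<^sub>R b)"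
      using expand[OF x] dir_deriv_frechet[OF Y x] X x by (simp add: vector_fields_def)
    also have "\<dots> = (\<Sum>b\<in>B. (X x \<bullet> b) *\<^sub>R dir_deriv Y x b)"
      using B(1) dir_deriv_frechet[OF Y x] by (simp add: linear_sum[OF F] linear_cmul[OF F] subset_iff)
    finally show ?thesis by simp
  qed
  have "Ck_on M T k (\<lambda>x. \<Sum>b\<in>B. (X x \<bullet> b) *\<^sub>R dir_deriv Y x b)" for k
  proof (intro Ck_on_sum Ck_on_bilinear[OF bounded_bilinear_scaleR])
    fix b assume "b \<in> B"
    show "Ck_on M T k (\<lambda>x. X x \<bullet> b)"
      using X by (intro Ck_on_bounded_linear[OF bounded_linear_inner_left])
        (simp add: vector_fields_def smooth_on_def)
    have "Ck_on M T (Suc k) Y"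
      using Y unfolding smooth_on_def by blast
    then show "Ck_on M T k (\<lambda>x. dir_deriv Y x b)"
      using \<open>b \<in> B\<close> B(1) by auto
  qed
  then show ?thesis
    unfolding smooth_on_def
    using Ck_on_cong[of "\<lambda>x. \<Sum>b\<in>B. (X x \<bullet> b) *\<^sub>R dir_deriv Y x b" "\<lambda>x. dir_deriv Y x (X x)"] eq
    by blast
qed

end

section \<open>Connections with given Christoffel symbols\<close>

definition christoffel_connection ::
  "('a::real_normed_vector \<Rightarrow> 'a \<Rightarrow> 'a \<Rightarrow> 'a) \<Rightarrow> ('a \<Rightarrow> 'a) \<Rightarrow> ('a \<Rightarrow> 'a) \<Rightarrow> 'a \<Rightarrow> 'a" where
  "christoffel_connection \<Gamma> X Y x = dir_deriv Y x (X x) + \<Gamma> x (X x) (Y x)"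

context affine_chart
begin

lemma affine_connection_christoffel:
  assumes bil: "\<And>x. x \<in> M \<Longrightarrow> bilinear (\<Gamma> x)"
    and field: "\<And>X Y. X \<in> vector_fields M T \<Longrightarrow> Y \<in> vector_fields M T \<Longrightarrow>
      (\<lambda>x. \<Gamma> x (X x) (Y x)) \<in> vector_fields M T"
  shows "affine_connection M T (christoffel_connection \<Gamma>)"
  unfolding affine_connection_def
proof (intro conjI ballI allI impI)
  fix X Y
  assume X: "X \<in> vector_fields M T" and Y: "Y \<in> vector_fields M T"
  show "christoffel_connection \<Gamma> X Y \<in> vector_fields M T"
    using X Y field[OF X Y] dir_deriv_in_T[OF Y] smooth_on_dir_deriv_field[of Y X]
    by (auto simp: vector_fields_def christoffel_connection_def [abs_def]
        intro: smooth_on_add subspace_add[OF subspace_T])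
  fix x assume x: "x \<in> M"
  have XT: "X x \<in> T"
    using X x by (simp add: vector_fields_def)
  have dY: "linear (frechet_derivative Y (at x within M))"
    using Y x by (intro has_derivative_linear[of Y _ "at x within M"] smooth_on_has_derivative)
      (auto simp: vector_fields_def)
  have deriv: "dir_deriv Y x v = frechet_derivative Y (at x within M) v" if "v \<in> T" for v
    using Y x that by (intro dir_deriv_frechet) (auto simp: vector_fields_def)
  {
    fix X' assume "X' \<in> vector_fields M T"
    then have "X' x \<in> T"
      using x by (simp add: vector_fields_def)
    then show "christoffel_connection \<Gamma> (\<lambda>y. X y + X' y) Y x =
        christoffel_connection \<Gamma> X Y x + christoffel_connection \<Gamma> X' Y x"
      using XT by (simp add: christoffel_connection_def deriv linear_add[OF dY]
          bilinear_ladd[OF bil[OF x]] subspace_add[OF subspace_T])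
  next
    fix f :: "'a \<Rightarrow> real"
    assume f: "smooth_on M T f"
    show "christoffel_connection \<Gamma> (\<lambda>y. f y *\<^sub>R X y) Y x = f x *\<^sub>R christoffel_connection \<Gamma> X Y x"
      using XT by (simp add: christoffel_connection_def deriv linear_cmul[OF dY]
          bilinear_lmul[OF bil[OF x]] subspace_scale[OF subspace_T] scaleR_add_right)
    have "dir_deriv (\<lambda>y. f y *\<^sub>R Y y) x (X x) =
        f x *\<^sub>R dir_deriv Y x (X x) + dir_deriv f x (X x) *\<^sub>R Y x"
    proof -
      have "((\<lambda>y. f y *\<^sub>R Y y) has_derivative
          (\<lambda>v. f x *\<^sub>R frechet_derivative Y (at x within M) v +
            frechet_derivative f (at x within M) v *\<^sub>R Y x)) (at x within M)"
        using f Y x by (intro has_derivative_scaleR smooth_on_has_derivative)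
          (auto simp: vector_fields_def)
      from dir_deriv_eq[OF this x XT] show ?thesis
        using deriv[OF XT] dir_deriv_frechet[OF f x XT] by simp
    qed
    then show "christoffel_connection \<Gamma> X (\<lambda>y. f y *\<^sub>R Y y) x =
        dir_deriv f x (X x) *\<^sub>R Y x + f x *\<^sub>R christoffel_connection \<Gamma> X Y x"
      by (simp add: christoffel_connection_def bilinear_rmul[OF bil[OF x]] scaleR_add_right)
  next
    fix Y' assume Y': "Y' \<in> vector_fields M T"
    have "((\<lambda>y. Y y + Y' y) has_derivative
        (\<lambda>v. frechet_derivative Y (at x within M) v + frechet_derivative Y' (at x within M) v))
        (at x within M)"
      using Y Y' x by (intro has_derivative_add smooth_on_has_derivative)
        (auto simp: vector_fields_def)
    from dir_deriv_eq[OF this x XT]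
    have "dir_deriv (\<lambda>y. Y y + Y' y) x (X x) = dir_deriv Y x (X x) + dir_deriv Y' x (X x)"
      using Y' deriv[OF XT] dir_deriv_frechet[of Y' x "X x"] x XT by (simp add: vector_fields_def)
    then show "christoffel_connection \<Gamma> X (\<lambda>y. Y y + Y' y) x =
        christoffel_connection \<Gamma> X Y x + christoffel_connection \<Gamma> X Y' x"
      by (simp add: christoffel_connection_def bilinear_radd[OF bil[OF x]])
  }
qed

lemma torsion_free_christoffel:
  assumes "\<And>x u v. x \<in> M \<Longrightarrow> \<Gamma> x u v = \<Gamma> x v u"
  shows "torsion_free M T (christoffel_connection \<Gamma>)"
  unfolding torsion_free_def christoffel_connection_def lie_bracket_def
  by (simp add: assms)

lemma const_vector_field: "v \<in> T \<Longrightarrow> (\<lambda>_. v) \<in> vector_fields M T"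
  by (simp add: vector_fields_def smooth_on_const)

lemma affine_connection_const_tangent:
  assumes "affine_connection M T D" "x \<in> M" "u \<in> T" "v \<in> T"
  shows "D (\<lambda>_. u) (\<lambda>_. v) x \<in> T"
proof -
  have "D (\<lambda>_. u) (\<lambda>_. v) \<in> vector_fields M T"
    using assms(1,3,4) const_vector_field unfolding affine_connection_def by blast
  then show ?thesis
    using assms(2) by (simp add: vector_fields_def)
qed

text \<open>
  The Koszul formula: cyclic permutation of compatibility with the metric. The brackets of constant
  fields vanish, so torsion-freeness makes the connection symmetric in them.
\<close>

lemma koszul_constant_fields:
  assumes D: "levi_civita_connection M T g D"
    and sym: "\<And>u v. u \<in> T \<Longrightarrow> v \<in> T \<Longrightarrow> g x u v = g x v u"
    and x: "x \<in> M" and T: "a \<in> T" "b \<in> T" "c \<in> T"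
  shows "2 * g x (D (\<lambda>_. a) (\<lambda>_. b) x) c =
    dir_deriv (\<lambda>y. g y b c) x a + dir_deriv (\<lambda>y. g y a c) x b - dir_deriv (\<lambda>y. g y a b) x c"
proof -
  have zero: "dir_deriv (\<lambda>_. v) x u = 0" for u v :: 'a
    by (simp add: dir_deriv_def)
  have comm: "D (\<lambda>_. u) (\<lambda>_. v) x = D (\<lambda>_. v) (\<lambda>_. u) x" if "u \<in> T" "v \<in> T" for u v
    using D x const_vector_field that
    unfolding levi_civita_connection_def torsion_free_def lie_bracket_def by (force simp: zero)
  have tan: "D (\<lambda>_. u) (\<lambda>_. v) x \<in> T" if "u \<in> T" "v \<in> T" for u v
    using D x that affine_connection_const_tangent by (simp add: levi_civita_connection_def)
  have comp: "dir_deriv (\<lambda>y. g y v w) x u =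
      g x (D (\<lambda>_. u) (\<lambda>_. v) x) w + g x v (D (\<lambda>_. u) (\<lambda>_. w) x)"
    if "u \<in> T" "v \<in> T" "w \<in> T" for u v w
  proof -
    have "metric_compatible M T g D"
      using D by (simp add: levi_civita_connection_def)
    from this [unfolded metric_compatible_def, rule_format,
        OF const_vector_field const_vector_field const_vector_field x, OF that]
    show ?thesis .
  qed
  show ?thesis
    using comp[of a b c] comp[of b a c] comp[of c a b] comm[of a b] comm[of a c] comm[of b c]
      sym[OF tan[of c a] T(2)] sym[OF T(2) tan[of a c]] sym[OF T(1) tan[of b c]]
      sym[of _ c] T tan by simp
qed

end

section \<open>Matrix products and averaging\<close>

lemma bounded_bilinear_matrix_mult:
  "bounded_bilinear ((**) :: real ^ 'm ^ 'n \<Rightarrow> real ^ 'k ^ 'm \<Rightarrow> real ^ 'k ^ 'n)"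
  unfolding bilinear_conv_bounded_bilinear [symmetric] bilinear_def
  by (auto intro!: linearI simp: matrix_matrix_mult_def vec_eq_iff sum.distrib [symmetric]
      sum_distrib_left algebra_simps)

interpretation matrix_mult: bounded_bilinear
  "(**) :: real ^ 'm ^ 'n \<Rightarrow> real ^ 'k ^ 'm \<Rightarrow> real ^ 'k ^ 'n"
  by (rule bounded_bilinear_matrix_mult)

lemma symmetric_matrix_inner:
  fixes A :: "real ^ 'n ^ 'n"
  assumes "transpose A = A"
  shows "x \<bullet> (A *v y) = (A *v x) \<bullet> y"
  by (metis assms dot_lmul_matrix transpose_matrix_vector)

text \<open>
  The orthogonal projection onto the constant vectors.
\<close>

definition mean_matrix :: "real ^ 'n ^ 'n" where
  "mean_matrix = (\<chi> i j. 1 / real CARD('n))"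

lemma mean_matrix_mult_vec: "(mean_matrix *v (x :: real ^ 'n)) $ i = (\<Sum>j\<in>UNIV. x $ j) / real CARD('n)"
  by (simp add: mean_matrix_def matrix_vector_mult_def sum_divide_distrib)

lemma mean_matrix_symmetric: "transpose mean_matrix = mean_matrix"
  by (simp add: mean_matrix_def transpose_def)

lemma mean_matrix_idem: "mean_matrix ** mean_matrix = (mean_matrix :: real ^ 'n ^ 'n)"
  by (simp add: mean_matrix_def matrix_matrix_mult_def)

lemma mean_matrix_tangent: "x \<in> simplex_tangent \<Longrightarrow> mean_matrix *v x = 0"
  by (simp add: vec_eq_iff mean_matrix_mult_vec simplex_tangent_def)

section \<open>The weighted Laplacian\<close>

lemma linear_laplacian: "linear (laplacian E \<omega>)"
  by (rule linearI)
    (simp_all add: matrix_eq vec_eq_iff matrix_vector_mult_add_rdistrib laplacian_mult_vec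
      scaleR_matrix_vector_assoc [symmetric] edge_mean_def sum.distrib [symmetric]
      sum_distrib_left algebra_simps add_divide_distrib)

locale weighted_graph =
  fixes E :: "('n::finite \<times> 'n) set" and \<omega> :: "'n \<Rightarrow> 'n \<Rightarrow> real"
  assumes graph: "connected_weighted_graph E \<omega>"
begin

abbreviation "L \<equiv> laplacian E \<omega>"

lemma weight_sym: "\<omega> i j = \<omega> j i"
  using graph by (simp add: connected_weighted_graph_def)

lemma weight_nonneg: "\<omega> i j \<ge> 0"
  using graph unfolding connected_weighted_graph_def by (metis less_imp_le order_refl)

lemma weight_pos: "(i, j) \<in> E \<Longrightarrow> \<omega> i j > 0"
  using graph by (simp add: connected_weighted_graph_def)

lemma sum_nbrs: "(\<Sum>j\<in>nbrs E i. \<omega> i j * f j) = (\<Sum>j\<in>UNIV. \<omega> i j * f j)"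
proof (rule sum.mono_neutral_left)
  have "\<omega> i j = 0" if "(i, j) \<notin> E" for j
    using graph that unfolding connected_weighted_graph_def by blast
  then show "\<forall>j\<in>UNIV - nbrs E i. \<omega> i j * f j = 0"
    by (simp add: nbrs_def)
qed auto

lemma laplacian_component:
  "(L a *v \<Phi>) $ i = (\<Sum>j\<in>UNIV. \<omega> i j * (edge_mean a i j * (\<Phi> $ i - \<Phi> $ j)))"
  by (simp add: laplacian_mult_vec sum_nbrs [symmetric] mult.assoc)

text \<open>
  Summation by parts on the graph: swapping the end points of an edge in half of the sum replaces the
  value of \<open>\<Phi>\<close> at a vertex by its difference along the edge.
\<close>

lemma laplacian_energy:
  "\<Phi> \<bullet> (L a *v \<Psi>) =
    (1/2) * (\<Sum>i\<in>UNIV. \<Sum>j\<in>UNIV. \<omega> i j * edge_mean a i j * (\<Phi> $ i - \<Phi> $ j) * (\<Psi> $ i - \<Psi> $ j))"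
proof -
  define c where "c i j = \<omega> i j * edge_mean a i j" for i j
  define S where "S = (\<Sum>i\<in>UNIV. \<Sum>j\<in>UNIV. c i j * \<Phi> $ i * (\<Psi> $ i - \<Psi> $ j))"
  have c: "c i j = c j i" for i j
    using weight_sym[of i j] by (simp add: c_def edge_mean_def add.commute)
  have "S = (\<Sum>i\<in>UNIV. \<Sum>j\<in>UNIV. c j i * \<Phi> $ j * (\<Psi> $ j - \<Psi> $ i))"
    unfolding S_def by (rule sum.swap)
  also have "\<dots> = (\<Sum>i\<in>UNIV. \<Sum>j\<in>UNIV. c i j * \<Phi> $ j * (\<Psi> $ j - \<Psi> $ i))"
    by (simp add: c)
  finally have "2 * S = S + (\<Sum>i\<in>UNIV. \<Sum>j\<in>UNIV. c i j * \<Phi> $ j * (\<Psi> $ j - \<Psi> $ i))"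
    by simp
  also have "\<dots> = (\<Sum>i\<in>UNIV. \<Sum>j\<in>UNIV. c i j * (\<Phi> $ i - \<Phi> $ j) * (\<Psi> $ i - \<Psi> $ j))"
    unfolding S_def sum.distrib [symmetric] by (intro sum.cong refl) (simp add: algebra_simps)
  finally have "2 * S = \<dots>" .
  moreover have "\<Phi> \<bullet> (L a *v \<Psi>) = S"
    by (simp add: S_def c_def inner_vec_def laplacian_component sum_distrib_left algebra_simps)
  ultimately show ?thesis
    by (simp add: c_def)
qed

lemma laplacian_symmetric: "transpose (L a) = L a"
proof -
  have "x \<bullet> (transpose (L a) *v y) = x \<bullet> (L a *v y)" for x y
  proof -
    have "x \<bullet> (transpose (L a) *v y) = y \<bullet> (L a *v x)"
      by (metis dot_lmul_matrix inner_commute transpose_matrix_vector)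
    also have "\<dots> = x \<bullet> (L a *v y)"
      by (simp add: laplacian_energy mult.commute mult.left_commute)
    finally show ?thesis .
  qed
  then show ?thesis
    by (metis matrix_eq vector_eq_ldot)
qed

text \<open>
  The polarised Dirichlet form depends linearly on the vertex weights \<open>a\<close>, through edge averages only.
  Since the edge terms are symmetric, both end points of an edge contribute equally, and the
  coefficient of \<open>a\<close> at a vertex is the sum over its neighbours. This is why the product of gradients
  appears in the connection.
\<close>

lemma edge_product_dual:
  "a \<bullet> edge_product E (graph_gradient \<omega> \<Phi>) (graph_gradient \<omega> \<Psi>) = \<Phi> \<bullet> (L a *v \<Psi>)"
proof -
  define d where "d i j = \<omega> i j * ((\<Phi> $ i - \<Phi> $ j) * (\<Psi> $ i - \<Psi> $ j))" for i j
  have d: "d i j = d j i" for i j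
    using weight_sym[of i j] by (simp add: d_def algebra_simps)
  have "(\<Sum>i\<in>UNIV. \<Sum>j\<in>UNIV. a $ j * d i j) = (\<Sum>i\<in>UNIV. \<Sum>j\<in>UNIV. a $ i * d j i)"
    by (rule sum.swap)
  then have swap: "(\<Sum>i\<in>UNIV. \<Sum>j\<in>UNIV. a $ j * d i j) = (\<Sum>i\<in>UNIV. \<Sum>j\<in>UNIV. a $ i * d i j)"
    by (simp add: d)
  have grad: "graph_gradient \<omega> \<Phi> i j * graph_gradient \<omega> \<Psi> i j = d i j" for i j
  proof -
    have "graph_gradient \<omega> \<Phi> i j * graph_gradient \<omega> \<Psi> i j =
        (sqrt (\<omega> i j) * sqrt (\<omega> i j)) * ((\<Phi> $ i - \<Phi> $ j) * (\<Psi> $ i - \<Psi> $ j))"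
      by (simp only: graph_gradient_def mult_ac)
    then show ?thesis
      by (simp add: d_def weight_nonneg)
  qed
  have "(\<Sum>j\<in>nbrs E i. d i j) = (\<Sum>j\<in>UNIV. d i j)" for i
    unfolding d_def by (rule sum_nbrs)
  then have "a \<bullet> edge_product E (graph_gradient \<omega> \<Phi>) (graph_gradient \<omega> \<Psi>) =
      (1/2) * (\<Sum>i\<in>UNIV. \<Sum>j\<in>UNIV. a $ i * d i j)"
    by (simp add: inner_vec_def edge_product_def grad sum_divide_distrib [symmetric]
        sum_distrib_left [symmetric])
  moreover have "\<Phi> \<bullet> (L a *v \<Psi>) =
      (1/4) * ((\<Sum>i\<in>UNIV. \<Sum>j\<in>UNIV. a $ i * d i j) + (\<Sum>i\<in>UNIV. \<Sum>j\<in>UNIV. a $ j * d i j))"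
    unfolding laplacian_energy d_def edge_mean_def sum.distrib [symmetric] sum_distrib_left
    by (intro sum.cong refl) (simp add: field_simps)
  ultimately show ?thesis
    by (simp add: swap)
qed

lemma laplacian_mean: "L a ** mean_matrix = 0" "mean_matrix ** L a = 0"
proof -
  show 1: "L a ** mean_matrix = 0"
    by (simp add: matrix_eq matrix_vector_mul_assoc [symmetric] vec_eq_iff laplacian_component
        mean_matrix_mult_vec)
  have "transpose (L a ** mean_matrix) = mean_matrix ** L a"
    by (simp add: matrix_transpose_mul mean_matrix_symmetric laplacian_symmetric)
  then show "mean_matrix ** L a = 0"
    by (simp add: 1 transpose_def vec_eq_iff)
qed

lemma laplacian_tangent: "L a *v \<Phi> \<in> simplex_tangent"
proof -
  have "mean_matrix *v (L a *v \<Phi>) = 0"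
    by (simp add: matrix_vector_mul_assoc laplacian_mean)
  then show ?thesis
    by (simp add: vec_eq_iff mean_matrix_mult_vec simplex_tangent_def)
qed

section \<open>The pseudo-inverse of the Laplacian\<close>

text \<open>
  Both quadratic forms are nonnegative. The energy vanishes only on functions that agree across every
  edge, hence on constants by connectedness; the mean then detects constants.
\<close>

lemma laplacian_regularised_ker:
  assumes \<rho>: "\<And>i. \<rho> $ i > 0" and ker: "(L \<rho> + mean_matrix) *v \<Phi> = 0"
  shows "\<Phi> = 0"
proof -
  define e where "e i j = \<omega> i j * edge_mean \<rho> i j * (\<Phi> $ i - \<Phi> $ j) * (\<Phi> $ i - \<Phi> $ j)" for i j
  have pos: "edge_mean \<rho> i j > 0" for i j
    using \<rho>[of i] \<rho>[of j] by (simp add: edge_mean_def)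
  have e: "e i j \<ge> 0" for i j
    using pos[of i j] weight_nonneg[of i j] by (simp add: e_def mult.assoc)
  define m where "m = (\<Sum>i\<in>UNIV. \<Phi> $ i)"
  have "0 = \<Phi> \<bullet> ((L \<rho> + mean_matrix) *v \<Phi>)"
    by (simp add: ker)
  also have "\<dots> = (1/2) * (\<Sum>i\<in>UNIV. \<Sum>j\<in>UNIV. e i j) + m * m / real CARD('n)"
    unfolding matrix_vector_mult_add_rdistrib inner_add_right laplacian_energy e_def
    by (simp add: inner_vec_def mean_matrix_mult_vec m_def sum_divide_distrib [symmetric]
        sum_distrib_right [symmetric])
  finally have 0: "(1/2) * (\<Sum>i\<in>UNIV. \<Sum>j\<in>UNIV. e i j) + m * m / real CARD('n) = 0" by simp
  have "(\<Sum>i\<in>UNIV. \<Sum>j\<in>UNIV. e i j) \<ge> 0"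
    by (intro sum_nonneg e)
  moreover have "m * m / real CARD('n) \<ge> 0"
    by simp
  ultimately have sum0: "(\<Sum>i\<in>UNIV. \<Sum>j\<in>UNIV. e i j) = 0" and "m * m / real CARD('n) = 0"
    using 0 by linarith+
  then have m: "m = 0"
    by simp
  have "e i j = 0" for i j
    using sum0 e by (simp add: sum_nonneg_eq_0_iff sum_nonneg)
  then have "\<Phi> $ i = \<Phi> $ j" if "(i, j) \<in> E" for i j
    using weight_pos[OF that] pos[of i j] unfolding e_def
    by (metis eq_iff_diff_eq_0 less_irrefl mult_eq_0_iff)
  then have edge: "\<Phi> $ i = \<Phi> $ j" if "(i, j) \<in> E" for i j
    using that .
  have "\<Phi> $ i = \<Phi> $ j" if "(i, j) \<in> E\<^sup>*" for i j
    using that by (induction rule: rtrancl_induct) (auto dest: edge)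
  then have const: "\<Phi> $ i = \<Phi> $ j" for i j
    using graph by (simp add: connected_weighted_graph_def)
  have "\<Phi> $ i = 0" for i
  proof -
    have "m = (\<Sum>j\<in>(UNIV :: 'n set). \<Phi> $ i)"
      unfolding m_def by (intro sum.cong refl const)
    with m show ?thesis by simp
  qed
  then show ?thesis
    by (simp add: vec_eq_iff)
qed

end

text \<open>
  Penrose's uniqueness argument: for two pseudo-inverses the projections \<open>A ** X\<close> and \<open>A ** Y\<close> have
  the same range, and self-adjointness makes them equal; likewise on the other side.
\<close>

lemma pseudo_inverse_eqI:
  fixes A :: "real ^ 'n ^ 'm"
  assumes X: "is_pseudo_inverse A X"
  shows "pseudo_inverse A = X"
  unfolding pseudo_inverse_def
proof (rule the_equality[where P = "is_pseudo_inverse A", OF X])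
  fix Y assume Y: "is_pseudo_inverse A Y"
  have ax: "A ** X = A ** Y"
  proof -
    have "A ** X = transpose (A ** X)"
      using X by (simp add: is_pseudo_inverse_def)
    also have "\<dots> = transpose ((A ** Y) ** (A ** X))"
      using Y by (simp add: is_pseudo_inverse_def matrix_mul_assoc)
    also have "\<dots> = transpose (A ** X) ** transpose (A ** Y)"
      by (rule matrix_transpose_mul)
    also have "\<dots> = A ** X ** A ** Y"
      using X Y by (simp add: is_pseudo_inverse_def matrix_mul_assoc)
    also have "\<dots> = A ** Y"
      using X by (simp add: is_pseudo_inverse_def)
    finally show ?thesis .
  qed
  have xa: "X ** A = Y ** A"
  proof -
    have "X ** A = transpose (X ** A)"
      using X by (simp add: is_pseudo_inverse_def)
    also have "\<dots> = transpose ((X ** A) ** (Y ** A))"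
      using Y by (simp add: is_pseudo_inverse_def matrix_mul_assoc [symmetric])
    also have "\<dots> = transpose (Y ** A) ** transpose (X ** A)"
      by (rule matrix_transpose_mul)
    also have "\<dots> = (Y ** A) ** (X ** A)"
      using X Y by (simp add: is_pseudo_inverse_def)
    also have "\<dots> = Y ** (A ** X ** A)"
      by (simp add: matrix_mul_assoc)
    also have "\<dots> = Y ** A"
      using X by (simp add: is_pseudo_inverse_def)
    finally show ?thesis .
  qed
  have "Y = Y ** A ** Y"
    using Y by (simp add: is_pseudo_inverse_def)
  also have "\<dots> = X ** (A ** X)"
    by (simp add: xa [symmetric] ax matrix_mul_assoc [symmetric])
  also have "\<dots> = X"
    using X by (simp add: is_pseudo_inverse_def matrix_mul_assoc)
  finally show "Y = X" .
qed

context weighted_graph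
begin

abbreviation "P \<rho> \<equiv> pseudo_inverse (L \<rho>)"

text \<open>
  Adding the projection \<open>J\<close> onto the kernel makes the Laplacian invertible, and subtracting \<open>J\<close> from
  the inverse removes the part that was added.
\<close>

lemma pseudo_inverse_laplacian:
  assumes "\<And>i. \<rho> $ i > 0"
  shows "L \<rho> ** P \<rho> = mat 1 - mean_matrix" "P \<rho> ** L \<rho> = mat 1 - mean_matrix"
    "mean_matrix ** P \<rho> = 0" "P \<rho> ** mean_matrix = 0"
proof -
  let ?J = "mean_matrix :: real ^ 'n ^ 'n"
  let ?A = "L \<rho> + ?J"
  obtain C where CA: "C ** ?A = mat 1"
    using laplacian_regularised_ker[OF assms] matrix_left_invertible_ker[of ?A] by auto
  then have AC: "?A ** C = mat 1"
    by (rule matrix_left_right_inverse1)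
  have "C ** (?A ** ?J) = ?J"
    by (simp add: matrix_mul_assoc CA)
  then have CJ: "C ** ?J = ?J"
    by (simp add: matrix_mult.add_left laplacian_mean mean_matrix_idem)
  have "(?J ** ?A) ** C = ?J"
    by (simp add: matrix_mul_assoc [symmetric] AC)
  then have JC: "?J ** C = ?J"
    by (simp add: matrix_mult.add_right laplacian_mean mean_matrix_idem)
  define X where "X = C - ?J"
  have LX: "L \<rho> ** X = mat 1 - ?J"
    using AC JC by (simp add: X_def matrix_mult.diff_right matrix_mult.add_left laplacian_mean algebra_simps)
  have XL: "X ** L \<rho> = mat 1 - ?J"
    using CA CJ by (simp add: X_def matrix_mult.diff_left matrix_mult.add_right laplacian_mean algebra_simps)
  have JX: "?J ** X = 0" and XJ: "X ** ?J = 0"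
    by (simp_all add: X_def matrix_mult.diff_right matrix_mult.diff_left CJ JC mean_matrix_idem)
  have "transpose (mat 1 - ?J) = mat 1 - ?J"
    by (simp add: transpose_def vec_eq_iff mat_def mean_matrix_def)
  then have "is_pseudo_inverse (L \<rho>) X"
    unfolding is_pseudo_inverse_def LX XL
    by (simp add: matrix_mult.diff_left laplacian_mean JX)
  then have "P \<rho> = X"
    by (rule pseudo_inverse_eqI)
  then show "L \<rho> ** P \<rho> = mat 1 - ?J" "P \<rho> ** L \<rho> = mat 1 - ?J" "?J ** P \<rho> = 0" "P \<rho> ** ?J = 0"
    by (simp_all add: LX XL JX XJ)
qed

end

section \<open>The pseudo-inverse as a smooth map on the simplex\<close>

lemma bounded_bilinear_matrix_vector_mult:
  "bounded_bilinear ((*v) :: real ^ 'm ^ 'n \<Rightarrow> real ^ 'm \<Rightarrow> real ^ 'n)"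
  unfolding bilinear_conv_bounded_bilinear [symmetric] bilinear_def
  by (auto intro!: linearI simp: matrix_vector_mult_def vec_eq_iff sum.distrib [symmetric]
      sum_distrib_left algebra_simps)

interpretation matrix_vector: bounded_bilinear "(*v) :: real ^ 'm ^ 'n \<Rightarrow> real ^ 'm \<Rightarrow> real ^ 'n"
  by (rule bounded_bilinear_matrix_vector_mult)

text \<open>
  The resolvent identity contains the value at \<open>y\<close> on the right, so it is used three times: to bound
  \<open>P y\<close> near \<open>x\<close> by absorption, to make \<open>P y - P x\<close> of first order, and, with that estimate
  inserted, to make the error of the linear approximation quadratic.
\<close>

lemma has_derivative_resolvent:
  fixes P :: "'a::real_normed_vector \<Rightarrow> real ^ 'n ^ 'n" and K :: "'a \<Rightarrow> real ^ 'n ^ 'n"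
  assumes K: "bounded_linear K"
    and resolvent: "\<And>y. y \<in> M \<Longrightarrow> P y - P x = - (P y ** K (y - x) ** P x)"
  shows "(P has_derivative (\<lambda>v. - (P x ** K v ** P x))) (at x within M)"
proof -
  obtain B where B: "B > 0" "\<And>(A :: real ^ 'n ^ 'n) (C :: real ^ 'n ^ 'n). norm (A ** C) \<le> norm A * norm C * B"
    using matrix_mult.pos_bounded by blast
  obtain N where N: "N > 0" "\<And>v. norm (K v) \<le> norm v * N"
    using bounded_linear.pos_bounded[OF K] by blast
  \<comment> \<open>The summand \<open>1\<close> keeps \<open>p\<close> positive when \<open>P x = 0\<close>.\<close>
  define p where "p = norm (P x) + 1"
  have p: "p > 0" "norm (P x) \<le> p"
    by (auto simp: p_def add_nonneg_pos)
  \<comment> \<open>By construction \<open>norm (A ** K h ** P x) \<le> q * norm A * norm h\<close>; on the ball of radius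
    \<open>1 / (2 * q)\<close> the term with \<open>P y\<close> can be absorbed.\<close>
  define q where "q = B * B * N * p"
  have q: "q > 0"
    using B(1) N(1) p(1) by (simp add: q_def)
  have triple: "norm (A ** K h ** P x) \<le> q * norm A * norm h" for A :: "real ^ 'n ^ 'n" and h
  proof -
    have "norm (A ** K h ** P x) \<le> norm (A ** K h) * norm (P x) * B"
      by (rule B(2))
    also have "\<dots> \<le> (norm A * norm (K h) * B) * p * B"
      using B p by (intro mult_right_mono mult_mono) auto
    also have "\<dots> \<le> (norm A * (norm h * N) * B) * p * B"
      using B(1) p(1) N(2)[of h] by (intro mult_right_mono mult_left_mono) auto
    also have "\<dots> = q * norm A * norm h"
      by (simp add: q_def mult_ac)
    finally show ?thesis .
  qed
  show ?thesis
  proof (rule has_derivativeI_sandwich[where e = "1 / (2 * q)" and H = "\<lambda>y. 2 * p * q * q * norm (y - x)"])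
    show "0 < 1 / (2 * q)"
      using q by simp
    show "bounded_linear (\<lambda>v. - (P x ** K v ** P x))"
      by (intro bounded_linear_minus
          bounded_linear_compose[OF matrix_mult.bounded_linear_left]
          bounded_linear_compose[OF matrix_mult.bounded_linear_right] K)
    have "((\<lambda>y. 2 * p * q * q * norm (y - x)) \<longlongrightarrow> 2 * p * q * q * norm (x - x)) (at x within M)"
      by (intro tendsto_intros)
    then show "((\<lambda>y. 2 * p * q * q * norm (y - x)) \<longlongrightarrow> 0) (at x within M)"
      by simp
    fix y assume y: "y \<in> M" "y \<noteq> x" "dist y x < 1 / (2 * q)"
    define h where "h = y - x"
    have h: "norm h > 0" "q * norm h \<le> 1 / 2"
      using y q by (simp_all add: h_def dist_norm field_simps)
    have diff: "P y - P x = - (P y ** K h ** P x)"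
      unfolding h_def by (rule resolvent[OF y(1)])
    have "norm (P y) \<le> norm (P x) + norm (P y - P x)"
      by (metis add.commute diff_add_cancel norm_triangle_ineq)
    also have "\<dots> \<le> p + q * norm (P y) * norm h"
      using triple[of "P y" h] p(2) by (simp add: diff)
    also have "\<dots> \<le> p + norm (P y) / 2"
      using mult_right_mono[OF h(2), of "norm (P y)"] by (simp add: mult_ac)
    finally have Py: "norm (P y) \<le> 2 * p"
      by simp
    have "norm (P y - P x - - (P x ** K h ** P x)) = norm ((P y - P x) ** K h ** P x)"
    proof -
      have "P y - P x - - (P x ** K h ** P x) = - ((P y - P x) ** K h ** P x)"
        by (subst matrix_mult.diff_left, subst matrix_mult.diff_left) (simp add: diff)
      then show ?thesis by simp
    qed
    also have "\<dots> \<le> q * norm (P y - P x) * norm h"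
      by (rule triple)
    also have "\<dots> \<le> q * (q * norm (P y) * norm h) * norm h"
      using triple[of "P y" h] q by (intro mult_right_mono mult_left_mono) (auto simp: diff)
    also have "\<dots> \<le> q * (q * (2 * p) * norm h) * norm h"
      using Py q by (intro mult_right_mono mult_left_mono) auto
    finally show "norm (P y - P x - - (P x ** K (y - x) ** P x)) / norm (y - x)
        \<le> 2 * p * q * q * norm (y - x)"
      using h(1) by (simp add: h_def [symmetric] divide_le_eq mult_ac)
  qed
qed

lemma subspace_simplex_tangent: "subspace simplex_tangent"
  by (simp add: subspace_def simplex_tangent_def sum.distrib sum_distrib_left [symmetric])

interpretation simplex: affine_chart "prob_simplex :: (real ^ 'n) set" simplex_tangent
proof
  show "subspace (simplex_tangent :: (real ^ 'n) set)"
    by (rule subspace_simplex_tangent)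
  fix x v :: "real ^ 'n"
  assume x: "x \<in> prob_simplex" and v: "v \<in> simplex_tangent"
  have "\<forall>\<^sub>F t in nhds 0. 0 < x $ i + t * v $ i" for i
  proof (rule order_tendstoD)
    have "((\<lambda>t. x $ i + t * v $ i) \<longlongrightarrow> x $ i + 0 * v $ i) (nhds 0)"
      by (intro tendsto_intros filterlim_ident)
    then show "((\<lambda>t. x $ i + t * v $ i) \<longlongrightarrow> x $ i) (nhds 0)"
      by simp
    show "0 < x $ i"
      using x by (simp add: prob_simplex_def)
  qed
  then have "\<forall>\<^sub>F t in nhds 0. \<forall>i. 0 < x $ i + t * v $ i"
    by (rule eventually_all_finite)
  then show "\<forall>\<^sub>F t in nhds 0. x + t *\<^sub>R v \<in> prob_simplex"
    by (rule eventually_mono)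
      (use x v in \<open>simp add: prob_simplex_def simplex_tangent_def sum.distrib
        sum_distrib_left [symmetric]\<close>)
qed

context weighted_graph
begin

lemma pseudo_inverse_simplex:
  assumes "\<rho> \<in> prob_simplex"
  shows "L \<rho> ** P \<rho> = mat 1 - mean_matrix" "P \<rho> ** L \<rho> = mat 1 - mean_matrix"
    "mean_matrix ** P \<rho> = 0" "P \<rho> ** mean_matrix = 0"
  using assms by (intro pseudo_inverse_laplacian; simp add: prob_simplex_def)+

text \<open>
  With \<open>\<^sup>T\<close> for transposition, \<open>P\<^sup>T = P\<^sup>T (L P) = (P\<^sup>T L) P = P\<close>, since \<open>L P\<close> is symmetric and \<open>P\<close> kills
  constants.
\<close>

lemma pseudo_inverse_symmetric:
  assumes "\<rho> \<in> prob_simplex"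
  shows "transpose (P \<rho>) = P \<rho>"
proof -
  let ?J = "mean_matrix :: real ^ 'n ^ 'n"
  note P = pseudo_inverse_simplex[OF assms]
  have "transpose (P \<rho>) ** ?J = transpose (?J ** P \<rho>)"
    by (simp add: matrix_transpose_mul mean_matrix_symmetric)
  then have PJ: "transpose (P \<rho>) ** ?J = 0"
    by (simp add: P transpose_def vec_eq_iff)
  have "transpose (P \<rho>) ** L \<rho> = transpose (L \<rho> ** P \<rho>)"
    by (simp add: matrix_transpose_mul laplacian_symmetric)
  also have "\<dots> = mat 1 - ?J"
    unfolding P by (simp add: transpose_def vec_eq_iff mat_def mean_matrix_def)
  finally have PL: "transpose (P \<rho>) ** L \<rho> = mat 1 - ?J" .
  have "transpose (P \<rho>) = transpose (P \<rho>) ** (L \<rho> ** P \<rho>)"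
    unfolding P by (simp add: matrix_mult.diff_right PJ)
  also have "\<dots> = P \<rho>"
    by (simp only: matrix_mul_assoc PL) (simp add: matrix_mult.diff_left P)
  finally show ?thesis .
qed

lemma laplacian_pseudo_inverse_tangent:
  assumes "\<rho> \<in> prob_simplex" "\<sigma> \<in> simplex_tangent"
  shows "L \<rho> *v (P \<rho> *v \<sigma>) = \<sigma>" "P \<rho> *v (L \<rho> *v \<sigma>) = \<sigma>"
  using assms by (simp_all add: matrix_vector_mul_assoc pseudo_inverse_simplex
      matrix_vector_mult_diff_rdistrib mean_matrix_tangent)

text \<open>
  As for inverse matrices, because all \<open>L \<rho>\<close> have the same kernel and the same range on the simplex.
\<close>

lemma pseudo_inverse_resolvent:
  assumes "\<rho> \<in> prob_simplex" "\<tau> \<in> prob_simplex"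
  shows "P \<tau> - P \<rho> = - (P \<tau> ** L (\<tau> - \<rho>) ** P \<rho>)"
proof -
  have "P \<tau> ** L \<rho> ** P \<rho> = P \<tau>"
    unfolding matrix_mul_assoc [symmetric] pseudo_inverse_simplex(1)[OF assms(1)]
    by (simp add: matrix_mult.diff_right pseudo_inverse_simplex(4)[OF assms(2)])
  moreover have "P \<tau> ** L \<tau> ** P \<rho> = P \<rho>"
    unfolding pseudo_inverse_simplex(2)[OF assms(2)]
    by (simp add: matrix_mult.diff_left pseudo_inverse_simplex(3)[OF assms(1)])
  ultimately show ?thesis
    by (simp add: linear_diff[OF linear_laplacian] matrix_mult.diff_left matrix_mult.diff_right)
qed

lemma has_derivative_pseudo_inverse:
  assumes "\<rho> \<in> prob_simplex"
  shows "(P has_derivative (\<lambda>v. - (P \<rho> ** L v ** P \<rho>))) (at \<rho> within prob_simplex)"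
  by (rule has_derivative_resolvent)
    (auto intro: pseudo_inverse_resolvent[OF assms] linear_conv_bounded_linear[THEN iffD1] linear_laplacian)

text \<open>
  The derivative is a polynomial in \<open>P\<close> itself, so each order of differentiability yields the next.
\<close>

lemma Ck_on_pseudo_inverse: "Ck_on prob_simplex simplex_tangent k P"
proof (induction k)
  case 0
  have "P differentiable_on prob_simplex"
    using has_derivative_pseudo_inverse unfolding differentiable_on_def differentiable_def by blast
  then show ?case
    by (simp add: differentiable_imp_continuous_on)
next
  case (Suc k)
  show ?case
  proof (rule simplex.Ck_on_SucI[OF has_derivative_pseudo_inverse])
    fix v :: "real ^ 'n"
    show "Ck_on prob_simplex simplex_tangent k (\<lambda>\<rho>. - (P \<rho> ** L v ** P \<rho>))"
      by (intro simplex.Ck_on_bounded_linear[OF bounded_linear_minus[OF bounded_linear_ident]]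
          simplex.Ck_on_bilinear[OF bounded_bilinear_matrix_mult] simplex.Ck_on_const Suc.IH)
  qed
qed

section \<open>The Levi-Civita connection\<close>

abbreviation "edge_pairing \<Phi> \<Psi> \<equiv> edge_product E (graph_gradient \<omega> \<Phi>) (graph_gradient \<omega> \<Psi>)"

text \<open>
  The claimed value of the connection on constant fields, which are coordinate fields of the affine
  chart: its Christoffel symbols.
\<close>

definition wasserstein_christoffel :: "real ^ 'n \<Rightarrow> real ^ 'n \<Rightarrow> real ^ 'n \<Rightarrow> real ^ 'n" where
  "wasserstein_christoffel \<rho> \<sigma>\<^sub>1 \<sigma>\<^sub>2 =
    - (1/2) *\<^sub>R (L \<sigma>\<^sub>1 *v (P \<rho> *v \<sigma>\<^sub>2) + L \<sigma>\<^sub>2 *v (P \<rho> *v \<sigma>\<^sub>1))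
    + (1/2) *\<^sub>R (L \<rho> *v edge_pairing (P \<rho> *v \<sigma>\<^sub>1) (P \<rho> *v \<sigma>\<^sub>2))"

lemma bilinear_edge_pairing: "bilinear (\<lambda>\<Phi> \<Psi>. edge_pairing \<Phi> \<Psi>)"
  unfolding bilinear_def
  by (auto intro!: linearI simp: edge_product_def graph_gradient_def vec_eq_iff sum.distrib [symmetric]
      sum_distrib_left algebra_simps add_divide_distrib)

lemma edge_pairing_commute: "edge_pairing \<Phi> \<Psi> = edge_pairing \<Psi> \<Phi>"
  by (simp add: edge_product_def mult.commute)

lemma christoffel_commute: "wasserstein_christoffel \<rho> \<sigma> \<tau> = wasserstein_christoffel \<rho> \<tau> \<sigma>"
  by (simp add: wasserstein_christoffel_def edge_pairing_commute add.commute)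

lemma bilinear_christoffel: "bilinear (wasserstein_christoffel \<rho>)"
proof -
  have "linear (\<lambda>\<sigma>. wasserstein_christoffel \<rho> \<sigma> \<tau>)" for \<tau>
    by (rule linearI)
      (simp_all add: wasserstein_christoffel_def linear_add[OF linear_laplacian]
        linear_cmul[OF linear_laplacian] bilinear_ladd[OF bilinear_edge_pairing]
        bilinear_lmul[OF bilinear_edge_pairing] matrix_vector.add_left matrix_vector.add_right
        matrix_vector.scaleR_left matrix_vector.scaleR_right algebra_simps)
  moreover from this have "linear (\<lambda>\<sigma>. wasserstein_christoffel \<rho> \<tau> \<sigma>)" for \<tau>
    by (subst christoffel_commute)
  ultimately show ?thesis
    by (simp add: bilinear_def)
qed

lemma christoffel_tangent: "wasserstein_christoffel \<rho> \<sigma> \<tau> \<in> simplex_tangent"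
  unfolding wasserstein_christoffel_def
  by (intro subspace_add subspace_scale subspace_simplex_tangent laplacian_tangent)

lemma christoffel_vector_field:
  assumes "X \<in> vector_fields prob_simplex simplex_tangent" "Y \<in> vector_fields prob_simplex simplex_tangent"
  shows "(\<lambda>\<rho>. wasserstein_christoffel \<rho> (X \<rho>) (Y \<rho>)) \<in> vector_fields prob_simplex simplex_tangent"
proof -
  have "Ck_on prob_simplex simplex_tangent k (\<lambda>\<rho>. wasserstein_christoffel \<rho> (X \<rho>) (Y \<rho>))" for k
  proof -
    have "Ck_on prob_simplex simplex_tangent k X" "Ck_on prob_simplex simplex_tangent k Y"
      using assms by (simp_all add: vector_fields_def smooth_on_def)
    moreover have "bounded_linear L"
      using linear_laplacian by (simp add: linear_conv_bounded_linear)
    moreover have "bounded_bilinear (\<lambda>\<Phi> \<Psi>. edge_pairing \<Phi> \<Psi>)"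
      using bilinear_edge_pairing by (simp add: bilinear_conv_bounded_bilinear)
    ultimately show ?thesis
      unfolding wasserstein_christoffel_def
      by (intro simplex.Ck_on_add simplex.Ck_on_bounded_linear[OF bounded_linear_scaleR_right]
          simplex.Ck_on_bilinear[OF bounded_bilinear_matrix_vector_mult]
          simplex.Ck_on_bounded_linear[of L]
          simplex.Ck_on_bilinear[of "\<lambda>\<Phi> \<Psi>. edge_pairing \<Phi> \<Psi>"]
          Ck_on_pseudo_inverse simplex.Ck_on_ident)
  qed
  then show ?thesis
    by (simp add: vector_fields_def smooth_on_def christoffel_tangent)
qed

text \<open>
  The right-hand side is the Koszul expression with the derivatives of the metric inserted, so these
  are the Christoffel symbols of the first kind.
\<close>

lemma christoffel_first_kind:
  assumes \<rho>: "\<rho> \<in> prob_simplex" and c: "c \<in> simplex_tangent"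
  shows "2 * (wasserstein_christoffel \<rho> a b \<bullet> (P \<rho> *v c)) =
    - ((P \<rho> *v b) \<bullet> (L a *v (P \<rho> *v c))) - (P \<rho> *v a) \<bullet> (L b *v (P \<rho> *v c))
    + (P \<rho> *v a) \<bullet> (L c *v (P \<rho> *v b))"
proof -
  have "(L \<rho> *v edge_pairing (P \<rho> *v a) (P \<rho> *v b)) \<bullet> (P \<rho> *v c) =
      edge_pairing (P \<rho> *v a) (P \<rho> *v b) \<bullet> c"
    using laplacian_pseudo_inverse_tangent(1)[OF \<rho> c]
    by (simp add: symmetric_matrix_inner[OF laplacian_symmetric, symmetric])
  also have "\<dots> = (P \<rho> *v a) \<bullet> (L c *v (P \<rho> *v b))"
    by (simp add: edge_product_dual inner_commute[of _ c])
  finally show ?thesis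
    by (simp add: wasserstein_christoffel_def inner_add_left inner_diff_left
        symmetric_matrix_inner[OF laplacian_symmetric] algebra_simps)
qed

lemma wasserstein_metric_commute:
  assumes "\<rho> \<in> prob_simplex"
  shows "wasserstein_metric E \<omega> \<rho> a b = wasserstein_metric E \<omega> \<rho> b a"
  using symmetric_matrix_inner[OF pseudo_inverse_symmetric[OF assms], of a b]
  by (simp add: wasserstein_metric_def inner_commute)

lemma dir_deriv_wasserstein_metric:
  assumes \<rho>: "\<rho> \<in> prob_simplex" and v: "v \<in> simplex_tangent"
    and Y: "smooth_on prob_simplex simplex_tangent Y" and Z: "smooth_on prob_simplex simplex_tangent Z"
  shows "dir_deriv (\<lambda>y. wasserstein_metric E \<omega> y (Y y) (Z y)) \<rho> v =
    wasserstein_metric E \<omega> \<rho> (dir_deriv Y \<rho> v) (Z \<rho>) + wasserstein_metric E \<omega> \<rho> (Y \<rho>) (dir_deriv Z \<rho> v)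
    - (P \<rho> *v Y \<rho>) \<bullet> (L v *v (P \<rho> *v Z \<rho>))"
proof -
  let ?Y' = "frechet_derivative Y (at \<rho> within prob_simplex)"
  let ?Z' = "frechet_derivative Z (at \<rho> within prob_simplex)"
  have "((\<lambda>y. Y y \<bullet> (P y *v Z y)) has_derivative
      (\<lambda>h. Y \<rho> \<bullet> (P \<rho> *v ?Z' h + - (P \<rho> ** L h ** P \<rho>) *v Z \<rho>) + ?Y' h \<bullet> (P \<rho> *v Z \<rho>)))
      (at \<rho> within prob_simplex)"
    by (intro bounded_bilinear.FDERIV[OF bounded_bilinear_inner] matrix_vector.FDERIV
        has_derivative_pseudo_inverse simplex.smooth_on_has_derivative Y Z \<rho>)
  from simplex.dir_deriv_eq[OF this \<rho> v] show ?thesis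
    using symmetric_matrix_inner[OF pseudo_inverse_symmetric[OF \<rho>], of "Y \<rho>"]
    by (simp add: wasserstein_metric_def simplex.dir_deriv_frechet[OF Y \<rho> v]
        simplex.dir_deriv_frechet[OF Z \<rho> v] inner_add_right inner_diff_right matrix_vector.minus_left
        matrix_vector_mul_assoc [symmetric])
qed

lemma levi_civita_christoffel:
  "levi_civita_connection prob_simplex simplex_tangent (wasserstein_metric E \<omega>)
    (christoffel_connection wasserstein_christoffel)"
  unfolding levi_civita_connection_def
proof (intro conjI)
  show "affine_connection prob_simplex simplex_tangent (christoffel_connection wasserstein_christoffel)"
    by (intro simplex.affine_connection_christoffel bilinear_christoffel christoffel_vector_field)
  show "torsion_free prob_simplex simplex_tangent (christoffel_connection wasserstein_christoffel)"
    by (intro simplex.torsion_free_christoffel christoffel_commute)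
  show "metric_compatible prob_simplex simplex_tangent (wasserstein_metric E \<omega>)
      (christoffel_connection wasserstein_christoffel)"
    unfolding metric_compatible_def
  proof (intro ballI)
    fix X Y Z :: "real ^ 'n \<Rightarrow> real ^ 'n" and \<rho> :: "real ^ 'n"
    assume fields: "X \<in> vector_fields prob_simplex simplex_tangent"
        "Y \<in> vector_fields prob_simplex simplex_tangent" "Z \<in> vector_fields prob_simplex simplex_tangent"
      and \<rho>: "\<rho> \<in> prob_simplex"
    let ?\<Gamma> = "wasserstein_christoffel \<rho>"
    let ?g = "wasserstein_metric E \<omega> \<rho>"
    have T: "X \<rho> \<in> simplex_tangent" "Y \<rho> \<in> simplex_tangent" "Z \<rho> \<in> simplex_tangent"
      using fields \<rho> by (simp_all add: vector_fields_def)
    have swap: "\<Phi> \<bullet> (L a *v \<Psi>) = \<Psi> \<bullet> (L a *v \<Phi>)" for \<Phi> \<Psi> a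
      using symmetric_matrix_inner[OF laplacian_symmetric] by (rule trans) (rule inner_commute)
    \<comment> \<open>In the sum of the two Koszul expressions the terms with weights \<open>Y \<rho>\<close> and \<open>Z \<rho>\<close> cancel.\<close>
    have "2 * (?g (?\<Gamma> (X \<rho>) (Y \<rho>)) (Z \<rho>) + ?g (Y \<rho>) (?\<Gamma> (X \<rho>) (Z \<rho>))) =
        - 2 * ((P \<rho> *v Y \<rho>) \<bullet> (L (X \<rho>) *v (P \<rho> *v Z \<rho>)))"
      unfolding wasserstein_metric_commute[OF \<rho>, of "Y \<rho>"]
      using christoffel_first_kind[OF \<rho> T(3), of "X \<rho>" "Y \<rho>"]
        christoffel_first_kind[OF \<rho> T(2), of "X \<rho>" "Z \<rho>"]
        swap[of "P \<rho> *v Z \<rho>" "X \<rho>" "P \<rho> *v Y \<rho>"]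
      by (simp add: wasserstein_metric_def)
    then show "dir_deriv (\<lambda>y. wasserstein_metric E \<omega> y (Y y) (Z y)) \<rho> (X \<rho>) =
        ?g (christoffel_connection wasserstein_christoffel X Y \<rho>) (Z \<rho>) +
        ?g (Y \<rho>) (christoffel_connection wasserstein_christoffel X Z \<rho>)"
      using fields dir_deriv_wasserstein_metric[OF \<rho> T(1), of Y Z]
      by (simp add: vector_fields_def christoffel_connection_def wasserstein_metric_def
          inner_add_left inner_add_right matrix_vector.add_right)
  qed
qed

text \<open>
  Testing against \<open>L \<rho> *v w\<close> gives the Euclidean square of \<open>w\<close>.
\<close>

lemma wasserstein_metric_nondegenerate:
  assumes \<rho>: "\<rho> \<in> prob_simplex" and w: "w \<in> simplex_tangent"
    and zero: "\<And>c. c \<in> simplex_tangent \<Longrightarrow> wasserstein_metric E \<omega> \<rho> w c = 0"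
  shows "w = 0"
  using zero[OF laplacian_tangent[of \<rho> w]] laplacian_pseudo_inverse_tangent(2)[OF \<rho> w]
  by (simp add: wasserstein_metric_def)

lemma levi_civita_constant_fields:
  assumes D: "levi_civita_connection prob_simplex simplex_tangent (wasserstein_metric E \<omega>) D"
    and \<rho>: "\<rho> \<in> prob_simplex" and a: "a \<in> simplex_tangent" and b: "b \<in> simplex_tangent"
  shows "D (\<lambda>_. a) (\<lambda>_. b) \<rho> = wasserstein_christoffel \<rho> a b"
proof -
  let ?g = "wasserstein_metric E \<omega>"
  let ?d = "D (\<lambda>_. a) (\<lambda>_. b) \<rho>"
  have d: "?d \<in> simplex_tangent"
    using simplex.affine_connection_const_tangent[of D \<rho> a b] D \<rho> a b
    by (simp add: levi_civita_connection_def)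
  have deriv: "dir_deriv (\<lambda>y. ?g y u w) \<rho> v = - ((P \<rho> *v u) \<bullet> (L v *v (P \<rho> *v w)))"
    if "v \<in> simplex_tangent" for u v w
    using dir_deriv_wasserstein_metric[OF \<rho> that simplex.smooth_on_const simplex.smooth_on_const, of u w]
    by (simp add: wasserstein_metric_def dir_deriv_def)
  have "?g \<rho> (?d - wasserstein_christoffel \<rho> a b) c = 0" if c: "c \<in> simplex_tangent" for c
  proof -
    have "2 * ?g \<rho> ?d c = 2 * ?g \<rho> (wasserstein_christoffel \<rho> a b) c"
      using simplex.koszul_constant_fields[OF D wasserstein_metric_commute[OF \<rho>] \<rho> a b c,
          unfolded deriv[OF a] deriv[OF b] deriv[OF c]]
        christoffel_first_kind[OF \<rho> c, of a b]
      by (simp add: wasserstein_metric_def)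
    then show ?thesis
      by (simp add: wasserstein_metric_def inner_diff_left)
  qed
  then have "?d - wasserstein_christoffel \<rho> a b = 0"
    by (rule wasserstein_metric_nondegenerate[OF \<rho> subspace_diff[OF subspace_simplex_tangent d christoffel_tangent]])
  then show ?thesis
    by simp
qed

end

theorem proposition3:
  fixes E :: "('n::finite \<times> 'n) set" and \<omega> :: "'n \<Rightarrow> 'n \<Rightarrow> real"
  assumes "connected_weighted_graph E \<omega>"
  shows "(\<exists>D. levi_civita_connection prob_simplex simplex_tangent (wasserstein_metric E \<omega>) D) \<and>
    (\<forall>D. levi_civita_connection prob_simplex simplex_tangent (wasserstein_metric E \<omega>) D \<longrightarrow>
      (\<forall>\<rho>\<in>prob_simplex. \<forall>\<sigma>\<^sub>1\<in>simplex_tangent. \<forall>\<sigma>\<^sub>2\<in>simplex_tangent.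
        D (\<lambda>_. \<sigma>\<^sub>1) (\<lambda>_. \<sigma>\<^sub>2) \<rho> =
          - (1/2) *\<^sub>R
            (laplacian E \<omega> \<sigma>\<^sub>1 *v (pseudo_inverse (laplacian E \<omega> \<rho>) *v \<sigma>\<^sub>2) +
             laplacian E \<omega> \<sigma>\<^sub>2 *v (pseudo_inverse (laplacian E \<omega> \<rho>) *v \<sigma>\<^sub>1))
          + (1/2) *\<^sub>R
            (laplacian E \<omega> \<rho> *v
              edge_product E
                (graph_gradient \<omega> (pseudo_inverse (laplacian E \<omega> \<rho>) *v \<sigma>\<^sub>1))
                (graph_gradient \<omega> (pseudo_inverse (laplacian E \<omega> \<rho>) *v \<sigma>\<^sub>2)))))"
proof -
  interpret weighted_graph E \<omega>
    using assms by unfold_locales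
  show ?thesis
  proof (intro conjI allI impI ballI)
    show "\<exists>D. levi_civita_connection prob_simplex simplex_tangent (wasserstein_metric E \<omega>) D"
      by (rule exI[where x = "christoffel_connection wasserstein_christoffel"])
        (rule levi_civita_christoffel)
  next
    fix D and \<rho> \<sigma>\<^sub>1 \<sigma>\<^sub>2 :: "real ^ 'n"
    assume "levi_civita_connection prob_simplex simplex_tangent (wasserstein_metric E \<omega>) D"
      and "\<rho> \<in> prob_simplex" "\<sigma>\<^sub>1 \<in> simplex_tangent" "\<sigma>\<^sub>2 \<in> simplex_tangent"
    from levi_civita_constant_fields[OF this] show "D (\<lambda>_. \<sigma>\<^sub>1) (\<lambda>_. \<sigma>\<^sub>2) \<rho> =
          - (1/2) *\<^sub>R (L \<sigma>\<^sub>1 *v (P \<rho> *v \<sigma>\<^sub>2) + L \<sigma>\<^sub>2 *v (P \<rho> *v \<sigma>\<^sub>1))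
          + (1/2) *\<^sub>R (L \<rho> *v edge_pairing (P \<rho> *v \<sigma>\<^sub>1) (P \<rho> *v \<sigma>\<^sub>2))"
      unfolding wasserstein_christoffel_def .
  qed
qed

end
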